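(* (Fundamental Theorem of Calculus) (a) Let $f\in\mathcal{A}_C$. Define $\Phi(x)=\int_{-\infty}^x f$. Then $\Phi\in\mathcal{B}_C$ and $\Phi'=f$ (distributional derivative). (b) Let $F\in C^0(\overline{\mathbb{R}})$. Then $\int_{-\infty}^x F'=F(x)-F(-\infty)$ for all $x\in\overline{\mathbb{R}}$, where $F'$ is the distributional derivative of $F$.
   Context: $\mathcal{D}=C_c^\infty(\mathbb{R})$ (real-valued), $\mathcal{D}'$ is the space of distributions, and $\langle T',\phi\rangle=-\langle T,\phi'\rangle$. Locally integrable functions are identified with distributions in the usual way. $\overline{\mathbb{R}}=[-\infty,\infty]$. $C^0(\overline{\mathbb{R}})$ is the set of continuous real functions $F$ on $\mathbb{R}$ for which the limits at $\pm\infty$ exist in $\mathbb{R}$, extended by $F(\pm\infty)=\lim_{\pm\infty}F$. $$\mathcal{B}_C=\{F\in C^0(\overline{\mathbb{R}}): F(-\infty)=0\},\qquad \mathcal{A}_C=\{f\in\mathcal{D}': f=F' \text{ for some } F\in\mathcal{B}_C\}.$$ For each $f\in\mathcal{A}_C$ the function $F\in\mathcal{B}_C$ with $F'=f$ is unique (the primitive of $f$). The integral of $f\in\mathcal{A}_C$ is $\int_{-\infty}^\infty f=F(\infty)$ and, for $a,b\in\overline{\mathbb{R}}$, $\int_a^b f=F(b)-F(a)$, where $F\in\mathcal{B}_C$ is the primitive of $f$. *)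

theory Defs
  imports "HOL-Analysis.Analysis"
begin

lemma compact_closed_subset:
  fixes S :: "real set"
  shows "compact S \<Longrightarrow> T \<subseteq> S \<Longrightarrow> closed T \<Longrightarrow> compact T"
  by (metis compact_Int_closed inf.absorb_iff2)

section \<open>Test functions and distributions on the real line\<close>

definition test_functions :: "(real \<Rightarrow> real) set" where
  "test_functions =
     {\<phi>. (\<forall>n x. (deriv ^^ n) \<phi> differentiable at x) \<and> compact (closure {x. \<phi> x \<noteq> 0})}"

definition test_tendsto :: "(nat \<Rightarrow> real \<Rightarrow> real) \<Rightarrow> (real \<Rightarrow> real) \<Rightarrow> bool" where
  "test_tendsto \<phi> \<psi> \<longleftrightarrow>
     (\<exists>K. compact K \<and> (\<forall>k. closure {x. \<phi> k x \<noteq> 0} \<subseteq> K)) \<and>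
     (\<forall>m. uniform_limit UNIV (\<lambda>k. (deriv ^^ m) (\<phi> k)) ((deriv ^^ m) \<psi>) sequentially)"

text \<open>
  A distribution is a sequentially continuous linear functional on the test functions; for linear
  functionals this is the same as continuity in the usual topology of test functions.
  Functionals are made \<open>undefined\<close> outside the test functions, so that equality
  of distributions is equality in HOL.
\<close>

definition distributions :: "((real \<Rightarrow> real) \<Rightarrow> real) set" where
  "distributions =
     {T \<in> extensional test_functions.
        (\<forall>\<phi>\<in>test_functions. \<forall>\<psi>\<in>test_functions. T (\<lambda>x. \<phi> x + \<psi> x) = T \<phi> + T \<psi>) \<and>
        (\<forall>c. \<forall>\<phi>\<in>test_functions. T (\<lambda>x. c * \<phi> x) = c * T \<phi>) \<and>
        (\<forall>\<phi> \<psi>. (\<forall>k. \<phi> k \<in> test_functions) \<and> \<psi> \<in> test_functions \<and> test_tendsto \<phi> \<psi> \<longrightarrow>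
           (\<lambda>k. T (\<phi> k)) \<longlonglongrightarrow> T \<psi>)}"

definition distr_of :: "(real \<Rightarrow> real) \<Rightarrow> (real \<Rightarrow> real) \<Rightarrow> real" where
  "distr_of F = (\<lambda>\<phi>\<in>test_functions. LINT x|lebesgue. F x * \<phi> x)"

definition distr_deriv :: "((real \<Rightarrow> real) \<Rightarrow> real) \<Rightarrow> (real \<Rightarrow> real) \<Rightarrow> real" where
  "distr_deriv T = (\<lambda>\<phi>\<in>test_functions. - T (deriv \<phi>))"

lemma test_functions_differentiable:
  "\<phi> \<in> test_functions \<Longrightarrow> (deriv ^^ n) \<phi> differentiable at x"
  by (simp add: test_functions_def)

lemma test_functions_DERIV:
  "\<phi> \<in> test_functions \<Longrightarrow> (\<phi> has_field_derivative deriv \<phi> x) (at x)"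
  using test_functions_differentiable[of \<phi> 0 x]
  by (simp add: DERIV_deriv_iff_real_differentiable)

lemma test_functions_continuous: "\<phi> \<in> test_functions \<Longrightarrow> continuous_on A \<phi>"
  by (meson DERIV_continuous_on DERIV_subset subset_UNIV test_functions_DERIV)

lemma closure_support_deriv:
  fixes \<phi> :: "real \<Rightarrow> real"
  shows "closure {x. deriv \<phi> x \<noteq> 0} \<subseteq> closure {x. \<phi> x \<noteq> 0}"
proof (rule closure_minimal)
  show "{x. deriv \<phi> x \<noteq> 0} \<subseteq> closure {x. \<phi> x \<noteq> 0}"
  proof (rule subsetI, rule ccontr)
    fix x assume x: "x \<in> {x. deriv \<phi> x \<noteq> 0}" "x \<notin> closure {x. \<phi> x \<noteq> 0}"
    have "eventually (\<lambda>y. y \<in> - closure {x. \<phi> x \<noteq> 0}) (nhds x)"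
      using x(2) by (intro eventually_nhds_in_open) auto
    then have "eventually (\<lambda>y. \<phi> y = 0) (nhds x)"
      by (rule eventually_mono) (use closure_subset[of "{x. \<phi> x \<noteq> 0}"] in auto)
    then have "deriv \<phi> x = deriv (\<lambda>_. 0) x"
      by (intro deriv_cong_ev) auto
    with x(1) show False by simp
  qed
qed simp

lemma deriv_in_test_functions:
  assumes "\<phi> \<in> test_functions"
  shows "deriv \<phi> \<in> test_functions"
proof -
  have "(deriv ^^ n) (deriv \<phi>) differentiable at x" for n x
    using test_functions_differentiable[OF assms, of "Suc n" x] by (simp only: funpow_Suc_right o_apply)
  moreover have "compact (closure {x. deriv \<phi> x \<noteq> 0})"
    using assms by (intro compact_closed_subset[OF _ closure_support_deriv[of \<phi>]])
      (simp_all add: test_functions_def)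
  ultimately show ?thesis by (simp add: test_functions_def)
qed

lemma test_tendsto_deriv: "test_tendsto \<phi> \<psi> \<Longrightarrow> test_tendsto (\<lambda>k. deriv (\<phi> k)) (deriv \<psi>)"
  unfolding test_tendsto_def
proof (elim conjE exE, intro conjI allI)
  fix K assume K: "compact K" "\<forall>k. closure {x. \<phi> k x \<noteq> 0} \<subseteq> K"
  then show "\<exists>K. compact K \<and> (\<forall>k. closure {x. deriv (\<phi> k) x \<noteq> 0} \<subseteq> K)"
    using closure_support_deriv by blast
next
  fix m
  assume "\<forall>m. uniform_limit UNIV (\<lambda>k. (deriv ^^ m) (\<phi> k)) ((deriv ^^ m) \<psi>) sequentially"
  then have "uniform_limit UNIV (\<lambda>k. (deriv ^^ Suc m) (\<phi> k)) ((deriv ^^ Suc m) \<psi>) sequentially"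
    by blast
  then show "uniform_limit UNIV (\<lambda>k. (deriv ^^ m) (deriv (\<phi> k))) ((deriv ^^ m) (deriv \<psi>)) sequentially"
    by (simp only: funpow_Suc_right o_apply)
qed

lemma test_functions_add:
  assumes "\<phi> \<in> test_functions" "\<psi> \<in> test_functions"
  shows "(\<lambda>x. \<phi> x + \<psi> x) \<in> test_functions"
proof -
  have eq: "(deriv ^^ n) (\<lambda>x. \<phi> x + \<psi> x) = (\<lambda>x. (deriv ^^ n) \<phi> x + (deriv ^^ n) \<psi> x)" for n
  proof (induction n)
    case (Suc n)
    show ?case
      using assms[THEN test_functions_differentiable]
      by (auto simp: Suc fun_eq_iff DERIV_deriv_iff_real_differentiable
          intro!: DERIV_imp_deriv DERIV_add)
  qed simp
  have "closure {x. \<phi> x + \<psi> x \<noteq> 0} \<subseteq> closure ({x. \<phi> x \<noteq> 0} \<union> {x. \<psi> x \<noteq> 0})"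
    by (intro closure_mono) auto
  moreover have "compact (closure ({x. \<phi> x \<noteq> 0} \<union> {x. \<psi> x \<noteq> 0}))"
    using assms by (simp add: test_functions_def compact_Un del: compact_closure)
  ultimately have "compact (closure {x. \<phi> x + \<psi> x \<noteq> 0})"
    using compact_closed_subset closed_closure by blast
  then show ?thesis
    using assms by (simp add: test_functions_def eq)
qed

lemma test_functions_cmult:
  assumes "\<phi> \<in> test_functions"
  shows "(\<lambda>x. c * \<phi> x) \<in> test_functions"
proof -
  have eq: "(deriv ^^ n) (\<lambda>x. c * \<phi> x) = (\<lambda>x. c * (deriv ^^ n) \<phi> x)" for n
  proof (induction n)
    case (Suc n)
    show ?case
      using assms[THEN test_functions_differentiable]
      by (auto simp: Suc fun_eq_iff DERIV_deriv_iff_real_differentiable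
          intro!: DERIV_imp_deriv DERIV_cmult)
  qed simp
  have "closure {x. c * \<phi> x \<noteq> 0} \<subseteq> closure {x. \<phi> x \<noteq> 0}"
    by (intro closure_mono) auto
  then have "compact (closure {x. c * \<phi> x \<noteq> 0})"
    using assms compact_closed_subset closed_closure unfolding test_functions_def by blast
  then show ?thesis
    using assms by (simp add: test_functions_def eq)
qed

lemma distr_deriv_in_distributions:
  assumes T: "T \<in> distributions"
  shows "distr_deriv T \<in> distributions"
proof -
  have add: "deriv (\<lambda>x. \<phi> x + \<psi> x) = (\<lambda>x. deriv \<phi> x + deriv \<psi> x)"
    if "\<phi> \<in> test_functions" "\<psi> \<in> test_functions" for \<phi> \<psi>
    using that by (intro ext DERIV_imp_deriv DERIV_add test_functions_DERIV)
  have cmult: "deriv (\<lambda>x. c * \<phi> x) = (\<lambda>x. c * deriv \<phi> x)" if "\<phi> \<in> test_functions" for c \<phi>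
    using that by (intro ext DERIV_imp_deriv DERIV_cmult test_functions_DERIV)
  have app: "distr_deriv T \<phi> = - T (deriv \<phi>)" if "\<phi> \<in> test_functions" for \<phi>
    using that by (simp add: distr_deriv_def)
  have Tadd: "T (\<lambda>x. \<phi> x + \<psi> x) = T \<phi> + T \<psi>"
    if "\<phi> \<in> test_functions" "\<psi> \<in> test_functions" for \<phi> \<psi>
    using T that unfolding distributions_def by blast
  have Tcmult: "T (\<lambda>x. c * \<phi> x) = c * T \<phi>" if "\<phi> \<in> test_functions" for c \<phi>
    using T that unfolding distributions_def by blast
  have Tlim: "(\<lambda>k. T (\<phi> k)) \<longlonglongrightarrow> T \<psi>"
    if "\<And>k. \<phi> k \<in> test_functions" "\<psi> \<in> test_functions" "test_tendsto \<phi> \<psi>" for \<phi> \<psi>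
    using T that unfolding distributions_def by blast
  show ?thesis
    unfolding distributions_def
  proof (intro CollectI conjI ballI allI impI)
    show "distr_deriv T \<in> extensional test_functions"
      by (simp add: distr_deriv_def)
  next
    fix \<phi> \<psi> assume "\<phi> \<in> test_functions" "\<psi> \<in> test_functions"
    then show "distr_deriv T (\<lambda>x. \<phi> x + \<psi> x) = distr_deriv T \<phi> + distr_deriv T \<psi>"
      by (simp add: app add Tadd test_functions_add deriv_in_test_functions)
  next
    fix c \<phi> assume "\<phi> \<in> test_functions"
    then show "distr_deriv T (\<lambda>x. c * \<phi> x) = c * distr_deriv T \<phi>"
      by (simp add: app cmult Tcmult test_functions_cmult deriv_in_test_functions)
  next
    fix \<phi> \<psi>
    assume *: "(\<forall>k. \<phi> k \<in> test_functions) \<and> \<psi> \<in> test_functions \<and> test_tendsto \<phi> \<psi>"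
    then have "(\<lambda>k. - T (deriv (\<phi> k))) \<longlonglongrightarrow> - T (deriv \<psi>)"
      by (intro tendsto_minus Tlim deriv_in_test_functions test_tendsto_deriv) auto
    with * show "(\<lambda>k. distr_deriv T (\<phi> k)) \<longlonglongrightarrow> distr_deriv T \<psi>"
      by (simp add: app)
  qed
qed

lemma integrable_mult_test_function:
  assumes F: "\<And>K. compact K \<Longrightarrow> set_integrable lebesgue K F" and \<phi>: "\<phi> \<in> test_functions"
  shows "integrable lebesgue (\<lambda>x. F x * \<phi> x)"
proof -
  define K where "K = closure {x. \<phi> x \<noteq> 0}"
  have K: "compact K" using \<phi> by (simp add: K_def test_functions_def)
  have zero: "\<phi> x = 0" if "x \<notin> K" for x
    using that closure_subset[of "{x. \<phi> x \<noteq> 0}"] by (auto simp: K_def)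
  have "bounded (\<phi> ` K)"
    using K \<phi> by (intro compact_imp_bounded compact_continuous_image test_functions_continuous)
  then obtain B where B: "\<bar>\<phi> x\<bar> \<le> B" if "x \<in> K" for x
    by (auto simp: bounded_iff)
  have meas: "\<phi> \<in> borel_measurable lebesgue"
    using test_functions_continuous[OF \<phi>, of UNIV]
    by (intro measurable_completion) (simp add: borel_measurable_continuous_onI)
  have int: "integrable lebesgue (\<lambda>x. indicator K x * F x)"
    using F[OF K] by (simp add: set_integrable_def)
  have "integrable lebesgue (\<lambda>x. (indicator K x * F x) * \<phi> x)"
  proof (rule Bochner_Integration.integrable_bound[OF integrable_mult_right[OF int, of B]])
    show "(\<lambda>x. indicator K x * F x * \<phi> x) \<in> borel_measurable lebesgue"
      by (rule borel_measurable_times[OF borel_measurable_integrable[OF int] meas])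
    show "AE x in lebesgue. norm (indicator K x * F x * \<phi> x) \<le> norm (B * (indicator K x * F x))"
    proof (rule AE_I2)
      fix x
      have "\<bar>F x\<bar> * \<bar>\<phi> x\<bar> \<le> \<bar>B\<bar> * \<bar>F x\<bar>" if "x \<in> K"
        using mult_left_mono[of "\<bar>\<phi> x\<bar>" "\<bar>B\<bar>" "\<bar>F x\<bar>"] B[OF that] by (simp add: mult.commute)
      then show "norm (indicator K x * F x * \<phi> x) \<le> norm (B * (indicator K x * F x))"
        by (cases "x \<in> K") (auto simp: abs_mult)
    qed
  qed
  moreover have "(\<lambda>x. (indicator K x * F x) * \<phi> x) = (\<lambda>x. F x * \<phi> x)"
    by (auto simp: fun_eq_iff indicator_def zero)
  ultimately show ?thesis by simp
qed

lemma distr_of_in_distributions: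
  assumes F: "\<And>K. compact K \<Longrightarrow> set_integrable lebesgue K F"
  shows "distr_of F \<in> distributions"
proof -
  have int: "integrable lebesgue (\<lambda>x. F x * \<phi> x)" if "\<phi> \<in> test_functions" for \<phi>
    using F that by (rule integrable_mult_test_function)
  have "(\<lambda>k. LINT x|lebesgue. F x * \<phi> k x) \<longlonglongrightarrow> (LINT x|lebesgue. F x * \<psi> x)"
    if \<phi>: "\<And>k. \<phi> k \<in> test_functions" and \<psi>: "\<psi> \<in> test_functions" and lim: "test_tendsto \<phi> \<psi>"
    for \<phi> \<psi>
  proof -
    obtain K where K: "compact K" "\<And>k. closure {x. \<phi> k x \<noteq> 0} \<subseteq> K"
      using lim by (auto simp: test_tendsto_def)
    have zero: "\<phi> k x = 0" if "x \<notin> K" for k x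
      using that K(2)[of k] closure_subset[of "{x. \<phi> k x \<noteq> 0}"] by auto
    have unif: "uniform_limit UNIV \<phi> \<psi> sequentially"
      using lim by (auto simp: test_tendsto_def dest!: spec[of _ 0])
    have pw: "(\<lambda>k. \<phi> k x) \<longlonglongrightarrow> \<psi> x" for x
      by (rule tendsto_uniform_limitI[OF unif]) simp
    have zero': "\<psi> x = 0" if "x \<notin> K" for x
      using pw[of x] zero[OF that] by (simp add: LIMSEQ_const_iff)
    have intK: "integrable lebesgue (\<lambda>x. indicator K x * \<bar>F x\<bar>)"
      using integrable_abs[OF F[OF K(1), unfolded set_integrable_def]] by (simp add: abs_mult)
    define J where "J = (LINT x|lebesgue. indicator K x * \<bar>F x\<bar>)"
    have J: "J \<ge> 0" unfolding J_def by (intro Bochner_Integration.integral_nonneg) auto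
    show ?thesis
    proof (rule LIMSEQ_I)
      fix e :: real assume e: "e > 0"
      have "\<forall>\<^sub>F k in sequentially. \<forall>x\<in>UNIV. dist (\<phi> k x) (\<psi> x) < e / (J + 1)"
        using e J by (intro uniform_limitD[OF unif]) auto
      then obtain N where N: "\<And>k x. k \<ge> N \<Longrightarrow> \<bar>\<phi> k x - \<psi> x\<bar> < e / (J + 1)"
        by (auto simp: eventually_sequentially dist_real_def)
      have "norm ((LINT x|lebesgue. F x * \<phi> k x) - (LINT x|lebesgue. F x * \<psi> x)) < e" if k: "k \<ge> N" for k
      proof -
        have "norm ((LINT x|lebesgue. F x * \<phi> k x) - (LINT x|lebesgue. F x * \<psi> x))
            = \<bar>LINT x|lebesgue. F x * \<phi> k x - F x * \<psi> x\<bar>"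
          using int[OF \<phi>] int[OF \<psi>] by simp
        also have "\<dots> \<le> (LINT x|lebesgue. e / (J + 1) * (indicator K x * \<bar>F x\<bar>))"
        proof (rule integral_abs_bound_integral)
          show "integrable lebesgue (\<lambda>x. F x * \<phi> k x - F x * \<psi> x)"
            using int[OF \<phi>] int[OF \<psi>] by simp
          show "integrable lebesgue (\<lambda>x. e / (J + 1) * (indicator K x * \<bar>F x\<bar>))"
            by (rule integrable_mult_right) (rule intK)
          fix x :: real
          have "\<bar>F x * \<phi> k x - F x * \<psi> x\<bar> = \<bar>\<phi> k x - \<psi> x\<bar> * \<bar>F x\<bar>"
            by (simp add: abs_mult[symmetric] algebra_simps)
          also have "\<dots> \<le> e / (J + 1) * (indicator K x * \<bar>F x\<bar>)"
          proof (cases "x \<in> K")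
            case True
            then show ?thesis
              using mult_right_mono[OF less_imp_le[OF N[OF k, of x]], of "\<bar>F x\<bar>"] by simp
          qed (simp add: zero zero')
          finally show "\<bar>F x * \<phi> k x - F x * \<psi> x\<bar> \<le> e / (J + 1) * (indicator K x * \<bar>F x\<bar>)" .
        qed
        also have "\<dots> = e / (J + 1) * J" by (simp add: J_def)
        also have "\<dots> < e" using e J by (simp add: field_simps)
        finally show ?thesis .
      qed
      then show "\<exists>N. \<forall>k\<ge>N. norm ((LINT x|lebesgue. F x * \<phi> k x) - (LINT x|lebesgue. F x * \<psi> x)) < e"
        by blast
    qed
  qed
  moreover have "(LINT x|lebesgue. F x * (\<phi> x + \<psi> x)) =
      (LINT x|lebesgue. F x * \<phi> x) + (LINT x|lebesgue. F x * \<psi> x)"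
    if "\<phi> \<in> test_functions" "\<psi> \<in> test_functions" for \<phi> \<psi>
    using int[OF that(1)] int[OF that(2)] by (simp add: distrib_left)
  moreover have "(LINT x|lebesgue. F x * (c * \<phi> x)) = c * (LINT x|lebesgue. F x * \<phi> x)" for c \<phi>
    by (simp add: mult.left_commute[of _ c])
  ultimately show ?thesis
    by (simp add: distributions_def distr_of_def test_functions_add test_functions_cmult)
qed

section \<open>The continuous primitive integral\<close>

definition C0_ereal :: "(ereal \<Rightarrow> real) set" where
  "C0_ereal =
     {F. continuous_on UNIV (\<lambda>x::real. F (ereal x)) \<and>
         ((\<lambda>x::real. F (ereal x)) \<longlongrightarrow> F \<infinity>) at_top \<and>
         ((\<lambda>x::real. F (ereal x)) \<longlongrightarrow> F (-\<infinity>)) at_bot}"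

definition B_C :: "(ereal \<Rightarrow> real) set" where
  "B_C = {F \<in> C0_ereal. F (-\<infinity>) = 0}"

text \<open>The distributional derivative of (the restriction to the reals of) a function on the
  extended real line.\<close>

definition ddiff :: "(ereal \<Rightarrow> real) \<Rightarrow> (real \<Rightarrow> real) \<Rightarrow> real" where
  "ddiff F = distr_deriv (distr_of (\<lambda>x. F (ereal x)))"

definition A_C :: "((real \<Rightarrow> real) \<Rightarrow> real) set" where
  "A_C = {f \<in> distributions. \<exists>F\<in>B_C. f = ddiff F}"

definition primitive :: "((real \<Rightarrow> real) \<Rightarrow> real) \<Rightarrow> ereal \<Rightarrow> real" where
  "primitive f = (THE F. F \<in> B_C \<and> ddiff F = f)"

text \<open>Only meaningful for \<open>f \<in> A_C\<close>, where the primitive exists and is unique.\<close>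

definition dist_integral :: "ereal \<Rightarrow> ereal \<Rightarrow> ((real \<Rightarrow> real) \<Rightarrow> real) \<Rightarrow> real" where
  "dist_integral a b f = primitive f b - primitive f a"

end

theory Submission
  imports Defs "HOL-Computational_Algebra.Polynomial"
begin

text \<open>
  Everything rests on the uniqueness of the primitive: a continuous \<open>H\<close> with \<open>H' = 0\<close> as a
  distribution is constant. If \<open>H p < c < H q\<close>, let \<open>b\<close> be a smooth bump supported on a short
  interval to the right of \<open>0\<close>. Then \<open>b (x - p) - b (x - q)\<close> is the derivative of a test
  function \<open>\<phi>\<close>, and \<open>(c - H) \<phi>'\<close> is continuous, nonnegative and not identically zero, although its
  integral vanishes.
\<close>

section \<open>Smooth functions and their closure properties\<close>

definition smooth :: "(real \<Rightarrow> real) \<Rightarrow> bool" where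
  "smooth f \<longleftrightarrow> (\<forall>n x. (deriv ^^ n) f differentiable at x)"

text \<open>Derivatives are unique, so \<open>deriv\<close> maps \<open>C\<close> into itself and
  all iterates stay in \<open>C\<close>. Smoothness thus follows from a family closed under one
  differentiation, without a formula for the n-th derivative.\<close>

lemma smooth_coinduct:
  assumes "f \<in> C"
    and step: "\<And>f. f \<in> C \<Longrightarrow> \<exists>f'\<in>C. \<forall>x. (f has_field_derivative f' x) (at x)"
  shows "smooth f"
proof -
  have deriv: "deriv g \<in> C" if g: "g \<in> C" for g
  proof -
    obtain g' where g': "g' \<in> C" "\<And>x. (g has_field_derivative g' x) (at x)"
      using step[OF g] by blast
    then have "deriv g = g'"
      by (auto simp: fun_eq_iff intro: DERIV_imp_deriv)
    with g' show ?thesis by simp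
  qed
  have "(deriv ^^ n) f \<in> C" for n
    by (induction n) (auto simp: \<open>f \<in> C\<close> deriv)
  then show ?thesis
    unfolding smooth_def real_differentiable_def using step by blast
qed

lemma smooth_DERIV: "smooth f \<Longrightarrow> (f has_field_derivative deriv f x) (at x)"
  unfolding smooth_def DERIV_deriv_iff_real_differentiable by (drule spec[of _ 0]) simp

lemma smooth_deriv: "smooth f \<Longrightarrow> smooth (deriv f)"
  unfolding smooth_def
proof (intro allI)
  fix n x
  assume "\<forall>n x. (deriv ^^ n) f differentiable at x"
  then have "(deriv ^^ Suc n) f differentiable at x" by blast
  then show "(deriv ^^ n) (deriv f) differentiable at x"
    by (simp only: funpow_Suc_right o_apply)
qed

lemma smooth_antiderivative:
  assumes "\<And>x. (S has_field_derivative f x) (at x)" "smooth f"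
  shows "smooth S"
proof (rule smooth_coinduct[where C = "insert S {f. smooth f}"])
  fix g assume "g \<in> insert S {f. smooth f}"
  then show "\<exists>f'\<in>insert S {f. smooth f}. \<forall>x. (g has_field_derivative f' x) (at x)"
    using assms smooth_DERIV smooth_deriv by blast
qed simp

lemma smooth_diff:
  assumes "smooth f" "smooth g"
  shows "smooth (\<lambda>x. f x - g x)"
proof (rule smooth_coinduct[where C = "{\<lambda>x. f x - g x |f g. smooth f \<and> smooth g}"])
  fix h assume "h \<in> {\<lambda>x. f x - g x |f g. smooth f \<and> smooth g}"
  then obtain f g where h: "h = (\<lambda>x. f x - g x)" "smooth f" "smooth g" by auto
  then show "\<exists>f'\<in>{\<lambda>x. f x - g x |f g. smooth f \<and> smooth g}. \<forall>x. (h has_field_derivative f' x) (at x)"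
    by (intro bexI[of _ "\<lambda>x. deriv f x - deriv g x"] allI)
      (auto intro!: DERIV_diff smooth_DERIV smooth_deriv)
qed (use assms in auto)

text \<open>The factor \<open>k\<close> in the family absorbs the powers of \<open>m\<close> that
  the chain rule produces.\<close>

lemma smooth_affine:
  assumes "smooth f"
  shows "smooth (\<lambda>x. f (m * x + c))"
proof (rule smooth_coinduct[where C = "{\<lambda>x. k * f (m * x + c) |k f. smooth f}"])
  fix h assume "h \<in> {\<lambda>x. k * f (m * x + c) |k f. smooth f}"
  then obtain k f where h: "h = (\<lambda>x. k * f (m * x + c))" "smooth f" by auto
  have "(h has_field_derivative (k * m) * deriv f (m * x + c)) (at x)" for x
    unfolding h(1)
    by (rule derivative_eq_intros DERIV_chain2[OF smooth_DERIV[OF h(2)]] refl | simp)+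
  then show "\<exists>f'\<in>{\<lambda>x. k * f (m * x + c) |k f. smooth f}. \<forall>x. (h has_field_derivative f' x) (at x)"
    using smooth_deriv[OF h(2)] by (intro bexI[of _ "\<lambda>x. (k * m) * deriv f (m * x + c)"]) auto
qed (use assms in \<open>auto intro!: exI[of _ 1]\<close>)

text \<open>By the Leibniz rule, the sums of products of smooth functions are closed under differentiation.\<close>

inductive_set product_sums :: "(real \<Rightarrow> real) set" where
  mult: "smooth f \<Longrightarrow> smooth g \<Longrightarrow> (\<lambda>x. f x * g x) \<in> product_sums"
| add: "f \<in> product_sums \<Longrightarrow> g \<in> product_sums \<Longrightarrow> (\<lambda>x. f x + g x) \<in> product_sums"

lemma smooth_mult:
  assumes "smooth f" "smooth g"
  shows "smooth (\<lambda>x. f x * g x)"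
proof (rule smooth_coinduct[where C = product_sums])
  fix h assume "h \<in> product_sums"
  then show "\<exists>h'\<in>product_sums. \<forall>x. (h has_field_derivative h' x) (at x)"
  proof induction
    case (mult f g)
    then have "(\<lambda>x. deriv f x * g x + deriv g x * f x) \<in> product_sums"
      by (intro product_sums.intros smooth_deriv)
    moreover have "((\<lambda>x. f x * g x) has_field_derivative deriv f x * g x + deriv g x * f x) (at x)" for x
      using mult by (intro DERIV_mult smooth_DERIV)
    ultimately show ?case by (intro bexI[of _ "\<lambda>x. deriv f x * g x + deriv g x * f x"]) auto
  next
    case (add f g)
    then obtain f' g' where "f' \<in> product_sums" "g' \<in> product_sums"
      "\<And>x. (f has_field_derivative f' x) (at x)" "\<And>x. (g has_field_derivative g' x) (at x)"
      by blast
    then show ?case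
      by (intro bexI[of _ "\<lambda>x. f' x + g' x"] allI DERIV_add product_sums.add) auto
  qed
qed (use assms in \<open>auto intro: product_sums.mult\<close>)

section \<open>A smooth bump on a bounded interval\<close>

text \<open>The family \<open>p (1/x) exp (-1/x)\<close>, extended by 0, is closed under differentiation.\<close>

definition flat :: "real poly \<Rightarrow> real \<Rightarrow> real" where
  "flat p x = (if x > 0 then poly p (inverse x) * exp (- inverse x) else 0)"

lemma poly_times_exp_tendsto_0:
  "((\<lambda>y::real. poly p y * exp (- y)) \<longlongrightarrow> 0) at_top"
proof -
  have "((\<lambda>y::real. \<Sum>i\<le>degree p. coeff p i * (y ^ i / exp y)) \<longlongrightarrow> (\<Sum>i\<le>degree p. coeff p i * 0)) at_top"
    by (intro tendsto_sum tendsto_mult tendsto_const tendsto_power_div_exp_0)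
  moreover have "(\<lambda>y. poly p y * exp (- y)) = (\<lambda>y. \<Sum>i\<le>degree p. coeff p i * (y ^ i / exp y))"
    by (simp add: poly_altdef sum_distrib_right exp_minus divide_inverse mult.assoc)
  ultimately show ?thesis by simp
qed

text \<open>On the right of 0, the substitution \<open>y = 1/x\<close> leads to the decay of
  \<open>p(y) exp(-y)\<close> at infinity.\<close>

lemma flat_tendsto_0: "(flat p \<longlongrightarrow> 0) (at 0)"
proof (rule filterlim_split_at_real)
  have "(flat p \<longlongrightarrow> 0) (at_left 0) \<longleftrightarrow> ((\<lambda>_::real. 0::real) \<longlongrightarrow> 0) (at_left 0)"
    by (intro tendsto_cong) (auto simp: flat_def eventually_at_filter)
  then show "(flat p \<longlongrightarrow> 0) (at_left 0)" by simp
  have "(flat p \<longlongrightarrow> 0) (at_right 0) \<longleftrightarrow> ((\<lambda>x. poly p (inverse x) * exp (- inverse x)) \<longlongrightarrow> 0) (at_right 0)"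
    by (intro tendsto_cong) (auto simp: flat_def eventually_at_filter)
  then show "(flat p \<longlongrightarrow> 0) (at_right 0)"
    using filterlim_compose[OF poly_times_exp_tendsto_0 filterlim_inverse_at_top_right, of p] by simp
qed

text \<open>With \<open>y = 1/x\<close>, so that \<open>y' = - y^2\<close>, the derivative of
  \<open>p(y) exp(-y)\<close> is \<open>y^2 (p - p')(y) exp(-y)\<close>; the polynomial
  \<open>[:0, 0, 1:]\<close> is \<open>y^2\<close>.\<close>

lemma DERIV_flat:
  "(flat p has_field_derivative flat ([:0, 0, 1:] * (p - pderiv p)) x) (at x)"
proof -
  consider "x > 0" | "x < 0" | "x = 0" by linarith
  then show ?thesis
  proof cases
    case 1
    have "((\<lambda>x. poly p (inverse x) * exp (- inverse x)) has_field_derivative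
        flat ([:0, 0, 1:] * (p - pderiv p)) x) (at x)"
      using 1 by (auto simp: flat_def power2_eq_square algebra_simps
          intro!: derivative_eq_intros DERIV_chain2[OF poly_DERIV])
    moreover have "eventually (\<lambda>y. flat p y = poly p (inverse y) * exp (- inverse y)) (nhds x)"
      using eventually_nhds_in_open[of "{0<..}" x] 1 by (auto simp: flat_def elim!: eventually_mono)
    ultimately show ?thesis by (subst DERIV_cong_ev) (auto simp: 1)
  next
    case 2
    have "eventually (\<lambda>y. flat p y = 0) (nhds x)"
      using eventually_nhds_in_open[of "{..<0}" x] 2 by (auto simp: flat_def elim!: eventually_mono)
    then show ?thesis by (subst DERIV_cong_ev[of _ x _ "\<lambda>_. 0" _ 0]) (use 2 in \<open>auto simp: flat_def\<close>)
  next
    case 3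
    \<comment> \<open>Dividing by \<open>h\<close> multiplies the polynomial by \<open>y\<close>, so
      the difference quotient at 0 is again in the family and tends to 0.\<close>
    have "(\<lambda>h. (flat p (0 + h) - flat p 0) / h) = flat ([:0, 1:] * p)"
      by (auto simp: fun_eq_iff flat_def divide_inverse)
    then have "(flat p has_field_derivative 0) (at 0)"
      unfolding DERIV_def by (simp only: flat_tendsto_0)
    then show ?thesis by (simp add: 3 flat_def)
  qed
qed

lemma smooth_flat: "smooth (flat p)"
  by (rule smooth_coinduct[where C = "range flat"]) (use DERIV_flat in blast)+

lemma smooth_bump:
  assumes "e > 0"
  obtains b where "smooth b" "\<And>x. b x \<ge> 0" "\<And>x. b x > 0 \<longleftrightarrow> 0 < x \<and> x < e"
proof
  \<comment> \<open>The first factor is positive exactly for \<open>x > 0\<close>, the reflected one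
    exactly for \<open>x < e\<close>.\<close>
  show "smooth (\<lambda>x. flat 1 x * flat 1 ((-1) * x + e))"
    by (intro smooth_mult smooth_affine smooth_flat)
qed (auto simp: flat_def)

section \<open>Test functions with a prescribed derivative\<close>

lemma smooth_test_function:
  assumes "smooth f" "\<And>x. x \<notin> {u..v} \<Longrightarrow> f x = 0"
  shows "f \<in> test_functions"
proof -
  have "closure {x. f x \<noteq> 0} \<subseteq> {u..v}"
    by (intro closure_minimal subsetI closed_atLeastAtMost) (use assms(2) in blast)
  then have "compact (closure {x. f x \<noteq> 0})"
    by (rule compact_closed_subset[OF compact_Icc]) simp
  with assms(1) show ?thesis by (simp add: test_functions_def smooth_def)
qed

lemma smooth_antiderivative_exists:
  assumes "smooth f"
  obtains S where "smooth S" "\<And>x. (S has_field_derivative f x) (at x)"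
proof -
  have "isCont f x" for x
    by (rule DERIV_isCont[OF smooth_DERIV[OF assms]])
  then obtain S where "\<And>x. (S has_vector_derivative f x) (at x)"
    using einterval_antiderivative[of "-\<infinity>" "\<infinity>" f] by auto
  then have S: "\<And>x. (S has_field_derivative f x) (at x)"
    by (simp add: has_real_derivative_iff_has_vector_derivative)
  with that smooth_antiderivative[OF S assms] show thesis by blast
qed

text \<open>The two shifted bumps have equal mass. Hence, for an antiderivative \<open>S\<close> of
  \<open>b\<close>, the terms of \<open>S (x - p) - S (x - q)\<close> agree not only to the left of
  both bumps but also to the right of both, and the difference has compact support.\<close>

lemma test_function_bump_diff:
  assumes e: "e > 0" and b: "smooth b" "\<And>x. x \<notin> {0<..<e} \<Longrightarrow> b x = 0"
  obtains \<phi> where "\<phi> \<in> test_functions" "deriv \<phi> = (\<lambda>x. b (x - p) - b (x - q))"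
proof -
  obtain S where S: "smooth S" "\<And>x. (S has_field_derivative b x) (at x)"
    using smooth_antiderivative_exists[OF b(1)] by blast
  \<comment> \<open>Only the open interval has to miss \<open>{0<..<e}\<close>, so the endpoints 0
    and \<open>e\<close> can serve as reference points in \<open>left\<close> and
    \<open>right\<close>.\<close>
  have const: "S x = S y" if "x \<le> y" "{x<..<y} \<inter> {0<..<e} = {}" for x y
  proof (cases "x = y")
    case False
    have "(S has_field_derivative 0) (at z)" if "x < z" "z < y" for z
    proof -
      have "z \<notin> {0<..<e}"
        using that \<open>{x<..<y} \<inter> {0<..<e} = {}\<close> by (metis disjoint_iff greaterThanLessThan_iff)
      then show ?thesis using S(2)[of z] b(2)[of z] by simp
    qed
    moreover have "continuous_on {x..y} S"
      by (intro continuous_at_imp_continuous_on ballI DERIV_isCont[OF S(2)])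
    moreover have "x < y" using \<open>x \<le> y\<close> False by simp
    ultimately show ?thesis
      by (intro DERIV_isconst_end[symmetric])
  qed simp
  have left: "S x = S 0" if "x \<le> 0" for x
    by (rule const) (use that in auto)
  have right: "S x = S e" if "x \<ge> e" for x
    by (rule const[symmetric]) (use that in auto)
  have shift: "smooth (\<lambda>x. S (x - c))" for c
    using smooth_affine[OF S(1), of 1 "- c"] by simp
  show thesis
  proof
    show "(\<lambda>x. S (x - p) - S (x - q)) \<in> test_functions"
    proof (rule smooth_test_function[where u = "min p q" and v = "max p q + e"])
      show "smooth (\<lambda>x. S (x - p) - S (x - q))"
        by (rule smooth_diff[OF shift shift])
      fix x assume "x \<notin> {min p q..max p q + e}"
      then consider "x \<le> p" "x \<le> q" | "x \<ge> p + e" "x \<ge> q + e" by force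
      then show "S (x - p) - S (x - q) = 0"
        using left[of "x - p"] left[of "x - q"] right[of "x - p"] right[of "x - q"]
        by cases auto
    qed
    have "((\<lambda>x. S (x - c)) has_field_derivative b (x - c)) (at x)" for x c
      using S(2)[of "x + - c"] DERIV_shift[of S "b (x - c)" x "- c"]
      unfolding diff_conv_add_uminus by blast
    then show "deriv (\<lambda>x. S (x - p) - S (x - q)) = (\<lambda>x. b (x - p) - b (x - q))"
      by (intro ext DERIV_imp_deriv DERIV_diff)
  qed
qed

section \<open>Integrals of continuous functions and of derivatives of test functions\<close>

lemma set_integrable_compact_continuous:
  fixes F :: "real \<Rightarrow> real"
  assumes "continuous_on UNIV F" "compact K"
  shows "set_integrable lebesgue K F"
proof -
  have "integrable lborel (\<lambda>x. indicator K x *\<^sub>R F x)"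
    using assms by (intro borel_integrable_compact) (auto intro: continuous_on_subset)
  \<comment> \<open>\<open>distr_of\<close> integrates over the completed measure, so integrability
    is carried over from \<open>lborel\<close>.\<close>
  then have "integrable (completion lborel) (\<lambda>x. indicator K x *\<^sub>R F x)"
    by (subst integrable_completion) (auto dest: borel_measurable_integrable)
  then show ?thesis unfolding set_integrable_def .
qed

text \<open>In other terms, constants have distributional derivative zero. This allows the level
  \<open>c\<close>, and later the value \<open>F (-\<infinity>)\<close>, to be subtracted
  freely.\<close>

lemma integral_deriv_test_function:
  assumes \<phi>: "\<phi> \<in> test_functions"
  shows "(LINT x|lebesgue. deriv \<phi> x) = 0"
proof -
  have "compact (closure {x. \<phi> x \<noteq> 0})" using \<phi> by (simp add: test_functions_def)
  \<comment> \<open>The strict bound makes \<open>\<phi>\<close> vanish at the endpoints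
    \<open>-r\<close> and \<open>r\<close> too.\<close>
  then obtain r where r: "r > 0" "\<And>x. x \<in> closure {x. \<phi> x \<noteq> 0} \<Longrightarrow> norm x < r"
    using bounded_pos_less[THEN iffD1, OF compact_imp_bounded] by blast
  have out: "x \<notin> closure {x. \<phi> x \<noteq> 0}" if "\<bar>x\<bar> \<ge> r" for x
    using r(2)[of x] that by fastforce
  have zero: "\<phi> x = 0" if "\<bar>x\<bar> \<ge> r" for x
    using out[OF that] closure_subset[of "{x. \<phi> x \<noteq> 0}"] by auto
  have deriv_zero: "deriv \<phi> x = 0" if "\<bar>x\<bar> \<ge> r" for x
    using out[OF that] closure_support_deriv[of \<phi>] closure_subset[of "{x. deriv \<phi> x \<noteq> 0}"] by auto
  have "(deriv \<phi> has_integral (\<phi> r - \<phi> (- r))) {-r..r}"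
    using r(1) test_functions_DERIV[OF \<phi>]
    by (intro fundamental_theorem_of_calculus)
      (auto simp flip: has_real_derivative_iff_has_vector_derivative intro: has_field_derivative_at_within)
  moreover have "\<phi> r = 0" "\<phi> (- r) = 0"
    using r(1) zero[of r] zero[of "- r"] by simp_all
  ultimately have "(deriv \<phi> has_integral 0) {-r..r}" by simp
  moreover have "deriv \<phi> x = 0" if "x \<notin> {-r..r}" for x
    using that by (intro deriv_zero) auto
  ultimately have "(deriv \<phi> has_integral 0) UNIV"
    by (rule has_integral_on_superset) auto
  \<comment> \<open>The factor 1 is the constant function multiplied with a test function.
    Integrability identifies the Lebesgue integral with the gauge integral just computed.\<close>
  moreover have "integrable lebesgue (\<lambda>x. 1 * deriv \<phi> x)"
    by (intro integrable_mult_test_function[OF set_integrable_compact_continuous[OF continuous_on_const]]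
        deriv_in_test_functions \<phi>)
  then have "(deriv \<phi> has_integral (LINT x|lebesgue. deriv \<phi> x)) UNIV"
    using has_integral_integral_lebesgue by auto
  ultimately show ?thesis by (rule has_integral_unique[symmetric])
qed

text \<open>The zero set has full measure, hence is dense; being closed, it is the whole
  line.\<close>

lemma continuous_nonneg_integral_0:
  fixes f :: "real \<Rightarrow> real"
  assumes "continuous_on UNIV f" "\<And>x. f x \<ge> 0" "integrable lebesgue f" "(LINT x|lebesgue. f x) = 0"
  shows "f x = 0"
proof -
  have "AE x in lebesgue. f x = 0"
    using integral_nonneg_eq_0_iff_AE[OF assms(3)] assms by auto
  moreover have "closed {x. f x = 0}"
    by (intro closed_Collect_eq assms continuous_on_const)
  ultimately show ?thesis
    using mem_closed_if_AE_lebesgue[of "{x. f x = 0}" x] by auto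
qed

section \<open>Continuous functions with zero distributional derivative\<close>

text \<open>One inequality suffices for constancy, because \<open>p\<close> and \<open>q\<close> are
  arbitrary and can be exchanged.\<close>

lemma annihilates_derivs_imp_le:
  fixes H :: "real \<Rightarrow> real"
  assumes H: "continuous_on UNIV H"
    and ann: "\<And>\<phi>. \<phi> \<in> test_functions \<Longrightarrow> (LINT x|lebesgue. H x * deriv \<phi> x) = 0"
  shows "H q \<le> H p"
proof (rule ccontr)
  assume "\<not> H q \<le> H p"
  then obtain c where c: "H p < c" "c < H q"
    using dense[of "H p" "H q"] by auto
  \<comment> \<open>One-sided limits match the bumps, which lie to the right of \<open>p\<close> and
    \<open>q\<close>.\<close>
  have tend: "(H \<longlongrightarrow> H x) (at_right x)" for x
  proof -
    have "isCont H x" using H by (simp add: continuous_on_eq_continuous_at)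
    from isContD[OF this] show ?thesis by (rule tendsto_within_subset) simp
  qed
  obtain e1 where e1: "e1 > p" "\<And>y. p < y \<Longrightarrow> y < e1 \<Longrightarrow> H y < c"
    using order_tendstoD(2)[OF tend c(1)] by (auto simp: eventually_at_right_field)
  obtain e2 where e2: "e2 > q" "\<And>y. q < y \<Longrightarrow> y < e2 \<Longrightarrow> H y > c"
    using order_tendstoD(1)[OF tend c(2)] by (auto simp: eventually_at_right_field)
  define e where "e = min (e1 - p) (e2 - q)"
  have e: "e > 0" using e1(1) e2(1) by (simp add: e_def)
  obtain b where b: "smooth b" "\<And>x. b x \<ge> 0" "\<And>x. b x > 0 \<longleftrightarrow> 0 < x \<and> x < e"
    using smooth_bump[OF e] by blast
  have b0: "b x = 0" if "x \<notin> {0<..<e}" for x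
    using b(2)[of x] b(3)[of x] that by auto
  obtain \<phi> where \<phi>: "\<phi> \<in> test_functions" "deriv \<phi> = (\<lambda>x. b (x - p) - b (x - q))"
    using test_function_bump_diff[OF e b(1) b0] by blast
  have int: "integrable lebesgue (\<lambda>x. G x * deriv \<phi> x)" if "continuous_on UNIV G" for G
    using that by (intro integrable_mult_test_function set_integrable_compact_continuous
        deriv_in_test_functions \<phi>(1))
  \<comment> \<open>The integral of \<open>f\<close> is 0: the first term because
    \<open>\<phi>\<close> has compact support, the second by \<open>ann\<close>.\<close>
  define f where "f = (\<lambda>x. c * deriv \<phi> x - H x * deriv \<phi> x)"
  have lower: "(c - H x) * b (x - p) \<ge> 0" for x
    using b(2)[of "x - p"] b0[of "x - p"] e1(2)[of x]
    by (cases "x - p \<in> {0<..<e}") (auto simp: e_def intro!: mult_nonneg_nonneg less_imp_le)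
  have upper: "(H x - c) * b (x - q) \<ge> 0" for x
    using b(2)[of "x - q"] b0[of "x - q"] e2(2)[of x]
    by (cases "x - q \<in> {0<..<e}") (auto simp: e_def intro!: mult_nonneg_nonneg less_imp_le)
  have f_eq: "f x = (c - H x) * b (x - p) + (H x - c) * b (x - q)" for x
    by (simp add: f_def \<phi>(2) algebra_simps)
  \<comment> \<open>The midpoint of the bump at \<open>p\<close> is a point where this bump is
    positive and \<open>H < c\<close>. There the first summand of \<open>f_eq\<close> is positive
    and the second nonnegative, which gives the contradiction.\<close>
  have "f (p + e / 2) = 0"
  proof (rule continuous_nonneg_integral_0[where f = f])
    show "continuous_on UNIV f"
      unfolding f_def
      by (intro continuous_intros H test_functions_continuous deriv_in_test_functions \<phi>(1))
    show "f x \<ge> 0" for x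
      using lower[of x] upper[of x] by (simp add: f_eq)
    show "integrable lebesgue f"
      unfolding f_def by (intro Bochner_Integration.integrable_diff int H continuous_on_const)
    show "(LINT x|lebesgue. f x) = 0"
      unfolding f_def using int[OF H] int[OF continuous_on_const, of c] ann[OF \<phi>(1)]
        integral_deriv_test_function[OF \<phi>(1)] by simp
  qed
  moreover have "(c - H (p + e / 2)) * b (p + e / 2 - p) > 0"
    using e b(3)[of "e / 2"] e1(2)[of "p + e / 2"] by (auto simp: e_def intro!: mult_pos_pos)
  ultimately show False
    using upper[of "p + e / 2"] by (simp add: f_eq)
qed

section \<open>Distributional derivatives and uniqueness of primitives\<close>

lemma ddiff_apply:
  "\<phi> \<in> test_functions \<Longrightarrow> ddiff F \<phi> = - (LINT x|lebesgue. F (ereal x) * deriv \<phi> x)"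
  by (simp add: ddiff_def distr_deriv_def distr_of_def deriv_in_test_functions)

lemma C0_ereal_continuous: "F \<in> C0_ereal \<Longrightarrow> continuous_on UNIV (\<lambda>x. F (ereal x))"
  by (simp add: C0_ereal_def)

lemma C0_ereal_integrable:
  assumes "F \<in> C0_ereal" "\<phi> \<in> test_functions"
  shows "integrable lebesgue (\<lambda>x. F (ereal x) * deriv \<phi> x)"
  using assms by (intro integrable_mult_test_function set_integrable_compact_continuous
      C0_ereal_continuous deriv_in_test_functions)

lemma ddiff_in_distributions: "F \<in> C0_ereal \<Longrightarrow> ddiff F \<in> distributions"
  unfolding ddiff_def
  by (intro distr_deriv_in_distributions distr_of_in_distributions
      set_integrable_compact_continuous C0_ereal_continuous)

lemma ddiff_diff_const:
  assumes F: "F \<in> C0_ereal"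
  shows "ddiff (\<lambda>x. F x - c) = ddiff F"
proof (rule extensionalityI[of _ test_functions])
  fix \<phi> :: "real \<Rightarrow> real" assume \<phi>: "\<phi> \<in> test_functions"
  have "integrable lebesgue (\<lambda>x. c * deriv \<phi> x)"
    using \<phi> by (intro integrable_mult_test_function[OF set_integrable_compact_continuous[OF continuous_on_const]]
        deriv_in_test_functions)
  then show "ddiff (\<lambda>x. F x - c) \<phi> = ddiff F \<phi>"
    using C0_ereal_integrable[OF F \<phi>] integral_deriv_test_function[OF \<phi>]
    by (simp add: ddiff_apply \<phi> left_diff_distrib)
qed (simp_all add: ddiff_def distr_deriv_def)

text \<open>\<open>ddiff\<close> sees only the real points; the values at the two infinities are
  recovered as limits.\<close>

lemma C0_ereal_eqI:
  assumes F: "F \<in> C0_ereal" and G: "G \<in> C0_ereal" and eq: "\<And>x. F (ereal x) = G (ereal x)"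
  shows "F = G"
proof
  fix x
  have "F \<infinity> = G \<infinity>"
    using F G by (intro tendsto_unique[of at_top "\<lambda>x. F (ereal x)"]) (auto simp: C0_ereal_def eq)
  moreover have "F (-\<infinity>) = G (-\<infinity>)"
    using F G by (intro tendsto_unique[of at_bot "\<lambda>x. F (ereal x)"]) (auto simp: C0_ereal_def eq)
  ultimately show "F x = G x" by (cases x) (auto simp: eq)
qed

text \<open>The difference is constant on the reals, and its limit 0 at \<open>-\<infinity>\<close>
  determines the constant.\<close>

lemma B_C_ddiff_inject:
  assumes F: "F \<in> B_C" and G: "G \<in> B_C" and eq: "ddiff F = ddiff G"
  shows "F = G"
proof -
  have C: "F \<in> C0_ereal" "G \<in> C0_ereal" using F G by (simp_all add: B_C_def)
  define H where "H = (\<lambda>x. F (ereal x) - G (ereal x))"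
  have "continuous_on UNIV H"
    unfolding H_def by (intro continuous_on_diff C0_ereal_continuous C)
  moreover have "(LINT x|lebesgue. H x * deriv \<phi> x) = 0" if "\<phi> \<in> test_functions" for \<phi>
    using that fun_cong[OF eq, of \<phi>] C0_ereal_integrable[OF C(1) that] C0_ereal_integrable[OF C(2) that]
    by (simp add: H_def ddiff_apply left_diff_distrib)
  ultimately have "H q \<le> H p" for p q
    by (rule annihilates_derivs_imp_le)
  then have "H = (\<lambda>_. H 0)" by (intro ext order.antisym)
  moreover have "(H \<longlongrightarrow> 0 - 0) at_bot"
    unfolding H_def using F G by (intro tendsto_diff) (auto simp: B_C_def C0_ereal_def)
  ultimately have "H 0 = 0"
    by (metis diff_self tendsto_const_iff trivial_limit_at_bot_linorder)
  with \<open>H = (\<lambda>_. H 0)\<close> have "H x = 0" for x by metis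
  then show ?thesis by (intro C0_ereal_eqI C) (simp add: H_def)
qed

text \<open>Uniqueness makes the definite description in \<open>primitive\<close> denote the given
  \<open>F\<close>.\<close>

lemma primitive_ddiff: "F \<in> B_C \<Longrightarrow> primitive (ddiff F) = F"
  unfolding primitive_def by (rule the_equality) (auto intro: B_C_ddiff_inject)

lemma C0_ereal_diff_in_B_C:
  assumes "F \<in> C0_ereal"
  shows "(\<lambda>x. F x - F (-\<infinity>)) \<in> B_C"
  using assms by (auto simp: B_C_def C0_ereal_def LIM_zero intro!: continuous_on_diff tendsto_diff)

theorem theorem4:
  shows "(\<forall>f\<in>A_C. \<forall>\<Phi> :: ereal \<Rightarrow> real.
            (\<forall>x. \<Phi> x = dist_integral (-\<infinity>) x f) \<longrightarrow> \<Phi> \<in> B_C \<and> ddiff \<Phi> = f) \<and>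
         (\<forall>F\<in>C0_ereal. ddiff F \<in> A_C \<and>
            (\<forall>x. dist_integral (-\<infinity>) x (ddiff F) = F x - F (-\<infinity>)))"
proof (intro conjI ballI allI impI)
  fix f and \<Phi> :: "ereal \<Rightarrow> real"
  assume f: "f \<in> A_C" and \<Phi>: "\<forall>x. \<Phi> x = dist_integral (-\<infinity>) x f"
  from f obtain F where F: "F \<in> B_C" "f = ddiff F" by (auto simp: A_C_def)
  \<comment> \<open>The integral is \<open>F x - F (-\<infinity>)\<close>, and the subtracted value
    is 0 in \<open>B_C\<close>.\<close>
  have "\<Phi> = F"
    using F(1) by (auto simp: \<Phi> F(2) dist_integral_def primitive_ddiff B_C_def)
  with F show "\<Phi> \<in> B_C" "ddiff \<Phi> = f" by simp_all
next
  fix F assume F: "F \<in> C0_ereal"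
  \<comment> \<open>Normalising at \<open>-\<infinity>\<close> keeps the derivative, so
    \<open>?G\<close> is the primitive of \<open>ddiff F\<close>.\<close>
  let ?G = "\<lambda>x. F x - F (-\<infinity>)"
  have G: "?G \<in> B_C" "ddiff ?G = ddiff F"
    by (rule C0_ereal_diff_in_B_C[OF F], rule ddiff_diff_const[OF F])
  then show "ddiff F \<in> A_C"
    unfolding A_C_def using ddiff_in_distributions[OF F] by (auto intro!: bexI[of _ ?G])
  fix x
  show "dist_integral (-\<infinity>) x (ddiff F) = F x - F (-\<infinity>)"
    using primitive_ddiff[OF G(1)] by (simp add: G(2) dist_integral_def)
qed

end
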